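(* Let $p\geq 1$, $q\geq 0$ be integers. The horospheres of $\mathcal H^{p,q}$ are the following subsets of $\{z>0\}$, for a parameter $c>0$: (1) horizontal hyperplanes $\{z=c\}$, if the point at infinity is $\infty$; (2) wedges of hyperplanes of the form $$z=c\,|x\cdot u-y\cdot v+d|$$ if the point at infinity corresponds to the vertical hyperplane $V_{\mathcal L}=\{(x,y,z):(x,y)\in\mathcal L,\ z>0\}$, for $\mathcal L$ the hyperplane of $\mathbb R^{p-1}\oplus\mathbb R^q$ of equation $x\cdot u-y\cdot v+d=0$ (for $(u,v)\in\mathbb R^{p-1,q}$ a nonzero null vector, i.e. $\|u\|=\|v\|$, and $d\in\mathbb R$); (3) piecewise quadric hypersurfaces of the form $$\|x-x_0\|^2-\|y-y_0\|^2+(z\pm c)^2=c^2$$ (the union of the two solution sets corresponding to the two signs) if the point at infinity is $(x_0,y_0,0)\in\partial\mathcal H^{p,q}$.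
   Context: $\mathbb R^{p,q+1}$ is $\mathbb R^{p+q+1}$ with the form $\langle X,Y\rangle=\sum_{i\le p}X_iY_i-\sum_{i=p+1}^{p+q+1}X_iY_i$; $\widetilde{\mathbb H}^{p,q}=\{X:\langle X,X\rangle=-1\}$, $\mathbb H^{p,q}=\widetilde{\mathbb H}^{p,q}/\{\pm\mathrm{Id}\}$, and $\partial_\infty\mathbb H^{p,q}=\mathrm P\{X:\langle X,X\rangle=0\}\subset\mathbb R\mathrm P^{p+q}$. The half-space model is $\mathcal H^{p,q}=\{(x,y,z)\in\mathbb R^{p-1}\oplus\mathbb R^q\oplus\mathbb R:z>0\}$ with metric $\frac{dx_1^2+\dots+dx_{p-1}^2-dy_1^2-\dots-dy_q^2+dz^2}{z^2}$, $\partial\mathcal H^{p,q}=\{z=0\}$, isometrically embedded in $\mathbb H^{p,q}$ by $$\iota_{p,q}(x,y,z)=\left[\frac{x}{z}:\frac{1-h(x,y)-z^2}{2z}:\frac{y}{z}:\frac{1+h(x,y)+z^2}{2z}\right],\quad h(x,y)=\|x\|^2-\|y\|^2,$$ where the entries are, in order, coordinates $1,\dots,p-1$; $p$; $p+1,\dots,p+q$; $p+q+1$. This formula, multiplied through by $z$, also defines $\iota_{p,q}$ on $\partial\mathcal H^{p,q}$ with values in $\partial_\infty\mathbb H^{p,q}$. $\|\cdot\|$ and $\cdot$ denote the Euclidean norm and inner product. A horosphere in $\mathbb H^{p,q}$ with point at infinity $[V]\in\partial_\infty\mathbb H^{p,q}$ is the projection $S_a$ to $\mathbb H^{p,q}$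 of $\{X\in\widetilde{\mathbb H}^{p,q}:\langle X,V\rangle=a\}$, for a nonzero null vector $V$ and a constant $a\neq0$. A horosphere of $\mathcal H^{p,q}$ is the preimage $\iota_{p,q}^{-1}(S_a)$ of a horosphere of $\mathbb H^{p,q}$. Points of $\partial_\infty\mathbb H^{p,q}$ are seen in the half-space model as follows: $(x_0,y_0,0)\in\partial\mathcal H^{p,q}$ is the point $\iota_{p,q}(x_0,y_0,0)$; $\infty$ is the class $[V]$ with $V_p=1$, $V_{p+q+1}=-1$ and all other coordinates zero; a vertical hyperplane $V_{\mathcal L}$ over a degenerate affine hyperplane $\mathcal L$ of $\mathbb R^{p-1,q}$ corresponds to the unique $[V]\in\partial_\infty\mathbb H^{p,q}$ such that the preimage under $\iota_{p,q}$ of the degenerate hyperplane $V^\perp\cap\mathbb H^{p,q}$ is $V_{\mathcal L}$. *)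

theory Defs
  imports Complex_Main "Jordan_Normal_Form.Matrix"
begin

text \<open>
  The dimensions \<open>p - 1\<close> and \<open>q\<close> may be \<open>0\<close>, so vectors are elements of \<^term>\<open>carrier_vec n\<close>
  rather than of a type indexed by its dimension.  Indices of \<^typ>\<open>real vec\<close> start at \<open>0\<close>:
  the coordinate \<open>X\<^sub>i\<close> of the usual notation is \<open>X $ (i - 1)\<close>.
\<close>

definition vnorm :: "real vec \<Rightarrow> real" where
  "vnorm x = sqrt (x \<bullet> x)"

definition form :: "nat \<Rightarrow> nat \<Rightarrow> real vec \<Rightarrow> real vec \<Rightarrow> real" where
  "form p q X Y = (\<Sum>i = 0..<p. X $ i * Y $ i) - (\<Sum>i = p..<p + q + 1. X $ i * Y $ i)"

definition hyperboloid :: "nat \<Rightarrow> nat \<Rightarrow> real vec set" where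
  "hyperboloid p q = {X \<in> carrier_vec (p + q + 1). form p q X X = -1}"

definition antipodal_rel :: "nat \<Rightarrow> nat \<Rightarrow> (real vec \<times> real vec) set" where
  "antipodal_rel p q =
     {(X, Y). X \<in> hyperboloid p q \<and> Y \<in> hyperboloid p q \<and> (Y = X \<or> Y = - X)}"

definition pseudohyp :: "nat \<Rightarrow> nat \<Rightarrow> real vec set set" where
  "pseudohyp p q = hyperboloid p q // antipodal_rel p q"

definition hyp_class :: "nat \<Rightarrow> nat \<Rightarrow> real vec \<Rightarrow> real vec set" where
  "hyp_class p q X = antipodal_rel p q `` {X}"

definition null_vectors :: "nat \<Rightarrow> nat \<Rightarrow> real vec set" where
  "null_vectors p q =
     {V \<in> carrier_vec (p + q + 1). V \<noteq> 0\<^sub>v (p + q + 1) \<and> form p q V V = 0}"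

text \<open>Projective space of \<open>\<real>\<^sup>n\<close>: a point is the set of all nonzero multiples of a nonzero vector.\<close>

definition proportional_rel :: "nat \<Rightarrow> (real vec \<times> real vec) set" where
  "proportional_rel n =
     {(V, W). V \<in> carrier_vec n - {0\<^sub>v n} \<and> W \<in> carrier_vec n - {0\<^sub>v n}
        \<and> (\<exists>t. t \<noteq> 0 \<and> W = t \<cdot>\<^sub>v V)}"

definition proj_class :: "nat \<Rightarrow> real vec \<Rightarrow> real vec set" where
  "proj_class n V = proportional_rel n `` {V}"

definition boundary_hyp :: "nat \<Rightarrow> nat \<Rightarrow> real vec set set" where
  "boundary_hyp p q = null_vectors p q // proportional_rel (p + q + 1)"

text \<open>
  Only the underlying set of the half-space model is used: its metric plays no role in the
  definition of horospheres, which is by pullback.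
\<close>

definition half_space :: "nat \<Rightarrow> nat \<Rightarrow> (real vec \<times> real vec \<times> real) set" where
  "half_space p q = {(x, y, z). x \<in> carrier_vec (p - 1) \<and> y \<in> carrier_vec q \<and> z > 0}"

definition hform :: "real vec \<Rightarrow> real vec \<Rightarrow> real" where
  "hform x y = (vnorm x)\<^sup>2 - (vnorm y)\<^sup>2"

text \<open>
  \<open>iota_lift\<close> is the vector of homogeneous coordinates of the embedding multiplied through by
  \<open>z\<close>.  For \<open>z > 0\<close> the vector \<open>(1/z) \<cdot>\<^sub>v iota_lift (x, y, z)\<close> lies on the hyperboloid; for
  \<open>z = 0\<close> the vector \<open>iota_lift (x, y, 0)\<close> is nonzero and null.
\<close>

definition iota_lift :: "real vec \<times> real vec \<times> real \<Rightarrow> real vec" where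
  "iota_lift = (\<lambda>(x, y, z).
     x @\<^sub>v vec_of_list [(1 - hform x y - z\<^sup>2) / 2] @\<^sub>v y @\<^sub>v vec_of_list [(1 + hform x y + z\<^sup>2) / 2])"

definition iota :: "nat \<Rightarrow> nat \<Rightarrow> real vec \<times> real vec \<times> real \<Rightarrow> real vec set" where
  "iota p q = (\<lambda>(x, y, z). hyp_class p q ((1 / z) \<cdot>\<^sub>v iota_lift (x, y, z)))"

definition iota_boundary :: "nat \<Rightarrow> nat \<Rightarrow> real vec \<Rightarrow> real vec \<Rightarrow> real vec set" where
  "iota_boundary p q x0 y0 = proj_class (p + q + 1) (iota_lift (x0, y0, 0))"

definition is_hyp_horosphere ::
  "nat \<Rightarrow> nat \<Rightarrow> real vec set \<Rightarrow> real vec set set \<Rightarrow> bool" where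
  "is_hyp_horosphere p q P S \<longleftrightarrow>
     (\<exists>V a. V \<in> null_vectors p q \<and> a \<noteq> 0 \<and> P = proj_class (p + q + 1) V
        \<and> S = hyp_class p q ` {X \<in> hyperboloid p q. form p q X V = a})"

definition pullback ::
  "nat \<Rightarrow> nat \<Rightarrow> real vec set set \<Rightarrow> (real vec \<times> real vec \<times> real) set" where
  "pullback p q S = {w \<in> half_space p q. iota p q w \<in> S}"

definition horospheres_at ::
  "nat \<Rightarrow> nat \<Rightarrow> real vec set \<Rightarrow> (real vec \<times> real vec \<times> real) set set" where
  "horospheres_at p q P = {pullback p q S | S. is_hyp_horosphere p q P S}"

definition horospheres :: "nat \<Rightarrow> nat \<Rightarrow> (real vec \<times> real vec \<times> real) set set" where
  "horospheres p q = {pullback p q S | S. \<exists>P. is_hyp_horosphere p q P S}"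

definition point_infinity :: "nat \<Rightarrow> nat \<Rightarrow> real vec set" where
  "point_infinity p q =
     proj_class (p + q + 1) (unit_vec (p + q + 1) (p - 1) - unit_vec (p + q + 1) (p + q))"

definition perp_hyperplane :: "nat \<Rightarrow> nat \<Rightarrow> real vec \<Rightarrow> real vec set set" where
  "perp_hyperplane p q V = {K \<in> pseudohyp p q. \<forall>X \<in> K. form p q X V = 0}"

definition vertical_hyperplane ::
  "nat \<Rightarrow> nat \<Rightarrow> real vec \<Rightarrow> real vec \<Rightarrow> real \<Rightarrow> (real vec \<times> real vec \<times> real) set" where
  "vertical_hyperplane p q u v d =
     {(x, y, z). (x, y, z) \<in> half_space p q \<and> x \<bullet> u - y \<bullet> v + d = 0}"

definition null_direction :: "nat \<Rightarrow> nat \<Rightarrow> real vec \<Rightarrow> real vec \<Rightarrow> bool" where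
  "null_direction p q u v \<longleftrightarrow>
     u \<in> carrier_vec (p - 1) \<and> v \<in> carrier_vec q
       \<and> (u, v) \<noteq> (0\<^sub>v (p - 1), 0\<^sub>v q) \<and> vnorm u = vnorm v"

text \<open>
  The description below determines a unique point when \<open>null_direction p q u v\<close> holds,
  which is the only case in which it is used.
\<close>

definition vertical_point :: "nat \<Rightarrow> nat \<Rightarrow> real vec \<Rightarrow> real vec \<Rightarrow> real \<Rightarrow> real vec set" where
  "vertical_point p q u v d =
     (THE P. \<exists>V \<in> null_vectors p q. P = proj_class (p + q + 1) V
        \<and> pullback p q (perp_hyperplane p q V) = vertical_hyperplane p q u v d)"

definition horizontal :: "nat \<Rightarrow> nat \<Rightarrow> real \<Rightarrow> (real vec \<times> real vec \<times> real) set" where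
  "horizontal p q c = {(x, y, z). (x, y, z) \<in> half_space p q \<and> z = c}"

definition wedge ::
  "nat \<Rightarrow> nat \<Rightarrow> real vec \<Rightarrow> real vec \<Rightarrow> real \<Rightarrow> real \<Rightarrow> (real vec \<times> real vec \<times> real) set" where
  "wedge p q u v d c =
     {(x, y, z). (x, y, z) \<in> half_space p q \<and> z = c * \<bar>x \<bullet> u - y \<bullet> v + d\<bar>}"

definition quadric ::
  "nat \<Rightarrow> nat \<Rightarrow> real vec \<Rightarrow> real vec \<Rightarrow> real \<Rightarrow> (real vec \<times> real vec \<times> real) set" where
  "quadric p q x0 y0 c =
     {(x, y, z). (x, y, z) \<in> half_space p q \<and>
        (vnorm (x - x0))\<^sup>2 - (vnorm (y - y0))\<^sup>2 + (z + c)\<^sup>2 = c\<^sup>2} \<union>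
     {(x, y, z). (x, y, z) \<in> half_space p q \<and>
        (vnorm (x - x0))\<^sup>2 - (vnorm (y - y0))\<^sup>2 + (z - c)\<^sup>2 = c\<^sup>2}"

end

theory Submission
  imports Defs
begin

text \<open>
  Write a null vector in blocks as \<open>V = (a, s, b, t)\<close>, with \<open>s\<close> and \<open>t\<close> the coordinates \<open>p\<close> and
  \<open>p + q + 1\<close>.  The representative of \<open>\<iota>(x, y, z)\<close> multiplied by \<open>z\<close> pairs with \<open>V\<close> to
  \<open>F_V (x, y, z) = x \<cdot> a - y \<cdot> b + (s - t) / 2 - (s + t) / 2 * (h(x, y) + z\<^sup>2)\<close>,
  so that, after division by \<open>\<plusminus>Id\<close>, the horospheres with point at infinity \<open>[V]\<close> pull back to the
  sets \<open>\<bar>F_V\<bar> = c z\<close> with \<open>c > 0\<close>; different representatives of \<open>[V]\<close> give the same family of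
  sets (\<open>horospheres_at_proj_class\<close>).  Everything follows by reading this equation in the three
  cases that exhaust the null vectors (\<open>null_point_cases\<close>).

  If \<open>s + t = 0\<close> and \<open>(a, b) = 0\<close>, then \<open>F_V\<close> is a nonzero constant, \<open>[V]\<close> is \<open>\<infinity>\<close>, and the sets
  are horizontal hyperplanes.  If \<open>s + t = 0\<close> and \<open>(a, b) \<noteq> 0\<close>, then \<open>(a, b)\<close> is a null direction,
  \<open>F_V = x \<cdot> a - y \<cdot> b + s\<close>, and the sets are wedges.  If \<open>s + t \<noteq> 0\<close>, then \<open>V\<close> is a multiple of
  the lift of the boundary point \<open>(x\<^sub>0, y\<^sub>0) = (a, b) / (s + t)\<close>, and completing the square in
  \<open>F_V = \<plusminus>c z\<close> gives the quadrics with centres at heights \<open>\<plusminus>c\<close>.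

  In the second case the point at infinity is specified only through its vertical hyperplane, so
  one also has to recover \<open>[V]\<close> from the zero set of \<open>F_V\<close>
  (\<open>vertical_hyperplane_determines_point\<close>): vertical lines in the zero set force \<open>s + t = 0\<close>, and
  affine functions with the same nonempty zero hyperplane are proportional
  (\<open>affine_function_proportional\<close>).
\<close>

section \<open>Euclidean inner products on coordinate vectors\<close>

lemma scalar_prod_self_nonneg: "0 \<le> (x :: real vec) \<bullet> x"
  by (simp add: scalar_prod_def sum_nonneg)

lemma scalar_prod_self_eq_0_iff:
  assumes "(x :: real vec) \<in> carrier_vec n"
  shows "x \<bullet> x = 0 \<longleftrightarrow> x = 0\<^sub>v n"
proof
  assume "x \<bullet> x = 0"
  then have "\<forall>i \<in> {0..<dim_vec x}. x $ i * x $ i = 0"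
    unfolding scalar_prod_def by (subst (asm) sum_nonneg_eq_0_iff) auto
  then show "x = 0\<^sub>v n"
    using assms by (intro eq_vecI) auto
qed (use assms in auto)

lemma vnorm_square: "(vnorm x)\<^sup>2 = x \<bullet> x"
  by (simp add: vnorm_def scalar_prod_self_nonneg)

lemma vnorm_square_diff:
  assumes "x \<in> carrier_vec n" "x0 \<in> carrier_vec n"
  shows "(vnorm (x - x0))\<^sup>2 = x \<bullet> x - 2 * (x \<bullet> x0) + x0 \<bullet> x0"
  using assms comm_scalar_prod[OF assms]
  by (simp add: vnorm_square minus_scalar_prod_distrib[of _ n] scalar_prod_minus_distrib[of _ n])

lemma hform_scalar_prod: "hform x y = x \<bullet> x - y \<bullet> y"
  by (simp add: hform_def vnorm_square)

text \<open>A linear functional determines the vector that represents it: test it on unit vectors.\<close>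

lemma vec_eq_of_scalar_prods:
  assumes "a \<in> carrier_vec n" "b \<in> carrier_vec n"
    and "\<And>x :: real vec. x \<in> carrier_vec n \<Longrightarrow> x \<bullet> a = x \<bullet> b"
  shows "a = b"
proof (rule eq_vecI)
  fix i assume "i < dim_vec b"
  then have i: "i < n" using assms(2) by simp
  then show "a $ i = b $ i"
    using assms(3)[of "unit_vec n i"] assms(1,2) by simp
qed (use assms in auto)

section \<open>Homogeneous coordinates in four blocks\<close>

definition homog :: "real vec \<Rightarrow> real \<Rightarrow> real vec \<Rightarrow> real \<Rightarrow> real vec" where
  "homog x s y t = x @\<^sub>v vec_of_list [s] @\<^sub>v y @\<^sub>v vec_of_list [t]"

lemma homog_carrier:
  assumes "p \<ge> 1" "x \<in> carrier_vec (p - 1)" "y \<in> carrier_vec q"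
  shows "homog x s y t \<in> carrier_vec (p + q + 1)"
  using assms by (intro carrier_vecI) (auto simp: homog_def)

lemma homog_index:
  assumes "p \<ge> 1" "x \<in> carrier_vec (p - 1)" "y \<in> carrier_vec q" "i < p + q + 1"
  shows "homog x s y t $ i =
    (if i < p - 1 then x $ i else if i = p - 1 then s else if i < p + q then y $ (i - p) else t)"
  using assms unfolding homog_def by (auto simp: vec_index_vCons)

lemma homog_cases:
  assumes "p \<ge> 1" "V \<in> carrier_vec (p + q + 1)"
  obtains a s b t where "a \<in> carrier_vec (p - 1)" "b \<in> carrier_vec q" "V = homog a s b t"
proof
  let ?a = "vec (p - 1) (\<lambda>i. V $ i)" and ?b = "vec q (\<lambda>i. V $ (i + p))"
  show a: "?a \<in> carrier_vec (p - 1)" and b: "?b \<in> carrier_vec q" by auto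
  show "V = homog ?a (V $ (p - 1)) ?b (V $ (p + q))"
  proof (rule eq_vecI)
    fix i assume "i < dim_vec (homog ?a (V $ (p - 1)) ?b (V $ (p + q)))"
    then have i: "i < p + q + 1" using homog_carrier[OF assms(1) a b, THEN carrier_vecD] by simp
    show "V $ i = homog ?a (V $ (p - 1)) ?b (V $ (p + q)) $ i"
      unfolding homog_index[OF assms(1) a b i] using i
      by (auto simp: less_Suc_eq)
  qed (use homog_carrier[OF assms(1) a b, THEN carrier_vecD] assms(2) in simp)
qed

lemma smult_homog:
  assumes "p \<ge> 1" "x \<in> carrier_vec (p - 1)" "y \<in> carrier_vec q"
  shows "c \<cdot>\<^sub>v homog x s y t = homog (c \<cdot>\<^sub>v x) (c * s) (c \<cdot>\<^sub>v y) (c * t)"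
proof (rule eq_vecI)
  note cx = smult_carrier_vec[THEN iffD2, OF assms(2)]
    and cy = smult_carrier_vec[THEN iffD2, OF assms(3)]
  fix i assume "i < dim_vec (homog (c \<cdot>\<^sub>v x) (c * s) (c \<cdot>\<^sub>v y) (c * t))"
  then have i: "i < p + q + 1"
    using homog_carrier[OF assms(1) cx cy, THEN carrier_vecD] by simp
  then have "(c \<cdot>\<^sub>v homog x s y t) $ i = c * homog x s y t $ i"
    using homog_carrier[OF assms, THEN carrier_vecD] by simp
  then show "(c \<cdot>\<^sub>v homog x s y t) $ i = homog (c \<cdot>\<^sub>v x) (c * s) (c \<cdot>\<^sub>v y) (c * t) $ i"
    unfolding homog_index[OF assms i] homog_index[OF assms(1) cx cy i] using i assms by auto
qed (simp add: homog_def)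

lemma homog_eq_0_iff:
  assumes "p \<ge> 1" "x \<in> carrier_vec (p - 1)" "y \<in> carrier_vec q"
  shows "homog x s y t = 0\<^sub>v (p + q + 1) \<longleftrightarrow> x = 0\<^sub>v (p - 1) \<and> s = 0 \<and> y = 0\<^sub>v q \<and> t = 0"
proof
  assume H: "homog x s y t = 0\<^sub>v (p + q + 1)"
  have z: "(if i < p - 1 then x $ i else if i = p - 1 then s
      else if i < p + q then y $ (i - p) else t) = 0" if "i < p + q + 1" for i
    using homog_index[OF assms that, of s t] H that by simp
  have "x $ i = 0" if "i < p - 1" for i using z[of i] that assms(1) by simp
  moreover have "y $ i = 0" if "i < q" for i
  proof -
    have "\<not> p + i < p - 1" "p + i \<noteq> p - 1" using assms(1) by linarith+
    then show ?thesis using z[of "p + i"] that by simp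
  qed
  moreover have "s = 0" using z[of "p - 1"] assms(1) by simp
  moreover have "t = 0"
  proof -
    have "\<not> p + q < p - 1" "p + q \<noteq> p - 1" using assms(1) by linarith+
    then show ?thesis using z[of "p + q"] by simp
  qed
  ultimately show "x = 0\<^sub>v (p - 1) \<and> s = 0 \<and> y = 0\<^sub>v q \<and> t = 0"
    using assms(2,3) by (auto intro!: eq_vecI)
next
  assume "x = 0\<^sub>v (p - 1) \<and> s = 0 \<and> y = 0\<^sub>v q \<and> t = 0"
  then show "homog x s y t = 0\<^sub>v (p + q + 1)"
    using homog_carrier[OF assms] assms(1)
    by (intro eq_vecI, subst homog_index[of p _ _ q]) auto
qed

lemma form_homog:
  assumes "p \<ge> 1" "x \<in> carrier_vec (p - 1)" "y \<in> carrier_vec q"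
    "a \<in> carrier_vec (p - 1)" "b \<in> carrier_vec q"
  shows "form p q (homog x s y t) (homog a s' b t') = x \<bullet> a + s * s' - y \<bullet> b - t * t'"
proof -
  let ?X = "homog x s y t" and ?A = "homog a s' b t'"
  note ix = homog_index[OF assms(1-3)] and ia = homog_index[OF assms(1,4,5)]
  have split: "{0..<p} = insert (p - 1) {0..<p - 1}" using assms(1) by auto
  have "(\<Sum>i = 0..<p. ?X $ i * ?A $ i) = s * s' + (\<Sum>i = 0..<p - 1. ?X $ i * ?A $ i)"
    unfolding split by (simp add: ix ia)
  also have "(\<Sum>i = 0..<p - 1. ?X $ i * ?A $ i) = x \<bullet> a"
    unfolding scalar_prod_def using assms by (intro sum.cong) (auto simp: ix ia)
  finally have pos: "(\<Sum>i = 0..<p. ?X $ i * ?A $ i) = s * s' + x \<bullet> a" .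
  have "(\<Sum>i = p..<p + q + 1. ?X $ i * ?A $ i) = (\<Sum>i = p..<p + q. ?X $ i * ?A $ i) + t * t'"
  proof -
    have "\<not> p + q < p - 1" "p + q \<noteq> p - 1" using assms(1) by linarith+
    then show ?thesis by (simp add: ix ia)
  qed
  also have "(\<Sum>i = p..<p + q. ?X $ i * ?A $ i) = (\<Sum>i = 0..<q. ?X $ (i + p) * ?A $ (i + p))"
    using sum.shift_bounds_nat_ivl[of "\<lambda>i. ?X $ i * ?A $ i" 0 p q] by (simp add: add.commute)
  also have "\<dots> = y \<bullet> b"
    unfolding scalar_prod_def using assms by (intro sum.cong) (auto simp: ix ia)
  finally have neg: "(\<Sum>i = p..<p + q + 1. ?X $ i * ?A $ i) = y \<bullet> b + t * t'" .
  show ?thesis unfolding form_def pos neg by simp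
qed

lemma form_smult:
  assumes "X \<in> carrier_vec (p + q + 1)"
  shows "form p q (c \<cdot>\<^sub>v X) V = c * form p q X V" "form p q V (c \<cdot>\<^sub>v X) = c * form p q V X"
  using assms unfolding form_def right_diff_distrib sum_distrib_left
  by (auto intro!: arg_cong2[of _ _ _ _ "(-)"] sum.cong)

lemma iota_lift_homog:
  "iota_lift (x, y, z) = homog x ((1 - hform x y - z\<^sup>2) / 2) y ((1 + hform x y + z\<^sup>2) / 2)"
  by (simp add: iota_lift_def homog_def)

text \<open>
  With \<open>r = h(x, y) + z\<^sup>2\<close>, the coordinates \<open>p\<close> and \<open>p + q + 1\<close> of the lift are \<open>(1 - r) / 2\<close> and
  \<open>(1 + r) / 2\<close>, and the form gives them opposite signs, so \<open>r\<close> acquires the coefficient \<open>s + t\<close>.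
  All nonlinear terms therefore disappear exactly when \<open>s + t = 0\<close>.
\<close>

lemma form_iota_lift:
  assumes "p \<ge> 1" "x \<in> carrier_vec (p - 1)" "y \<in> carrier_vec q"
    "a \<in> carrier_vec (p - 1)" "b \<in> carrier_vec q"
  shows "form p q (iota_lift (x, y, z)) (homog a s b t) =
    x \<bullet> a - y \<bullet> b + (s - t) / 2 - (s + t) / 2 * (hform x y + z\<^sup>2)"
  unfolding iota_lift_homog form_homog[OF assms] by (simp add: field_simps)

lemma iota_lift_carrier:
  assumes "p \<ge> 1" "(x, y, z) \<in> half_space p q"
  shows "iota_lift (x, y, z) \<in> carrier_vec (p + q + 1)"
proof -
  have "x \<in> carrier_vec (p - 1)" "y \<in> carrier_vec q" using assms(2) by (auto simp: half_space_def)
  then show ?thesis unfolding iota_lift_homog by (rule homog_carrier[OF assms(1)])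
qed

lemma iota_lift_in_hyperboloid:
  assumes "p \<ge> 1" "(x, y, z) \<in> half_space p q"
  shows "(1 / z) \<cdot>\<^sub>v iota_lift (x, y, z) \<in> hyperboloid p q"
proof -
  have w: "x \<in> carrier_vec (p - 1)" "y \<in> carrier_vec q" "z > 0"
    using assms(2) by (auto simp: half_space_def)
  have C: "iota_lift (x, y, z) \<in> carrier_vec (p + q + 1)" by (rule iota_lift_carrier[OF assms])
  have "form p q (iota_lift (x, y, z)) (iota_lift (x, y, z)) = - z\<^sup>2"
    unfolding iota_lift_homog form_homog[OF assms(1) w(1,2) w(1,2)] hform_scalar_prod
    by (simp add: field_simps power2_eq_square)
  then show ?thesis
    using C w(3) by (simp add: hyperboloid_def form_smult power2_eq_square)
qed

section \<open>Pulling back to the half-space\<close>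

lemma form_uminus:
  assumes "X \<in> carrier_vec (p + q + 1)"
  shows "form p q (- X) V = - form p q X V"
proof -
  have "- X = (- 1) \<cdot>\<^sub>v X" by auto
  then show ?thesis using form_smult(1)[OF assms, of "- 1" V] by simp
qed

lemma uminus_in_hyperboloid:
  assumes "X \<in> hyperboloid p q" shows "- X \<in> hyperboloid p q"
proof -
  have "- X = (- 1) \<cdot>\<^sub>v X" by auto
  then show ?thesis using assms by (simp add: hyperboloid_def form_smult)
qed

lemma hyp_class_eq:
  assumes "X \<in> hyperboloid p q"
  shows "hyp_class p q X = {X, - X}"
  using assms uminus_in_hyperboloid[OF assms]
  by (auto simp: hyp_class_def antipodal_rel_def)

lemma hyp_class_mem_level_iff:
  assumes "X \<in> hyperboloid p q"
  shows "hyp_class p q X \<in> hyp_class p q ` {Y \<in> hyperboloid p q. form p q Y V = a}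
    \<longleftrightarrow> \<bar>form p q X V\<bar> = \<bar>a\<bar>"
proof -
  have X: "X \<in> carrier_vec (p + q + 1)" using assms by (simp add: hyperboloid_def)
  have "hyp_class p q X \<in> hyp_class p q ` {Y \<in> hyperboloid p q. form p q Y V = a}
    \<longleftrightarrow> (\<exists>Y \<in> hyperboloid p q. form p q Y V = a \<and> (Y = X \<or> Y = - X))"
    by (auto simp: image_iff hyp_class_eq assms doubleton_eq_iff)
  also have "\<dots> \<longleftrightarrow> form p q X V = a \<or> form p q X V = - a"
    using assms uminus_in_hyperboloid[OF assms] form_uminus[OF X, of V] by auto
  finally show ?thesis by (simp add: abs_eq_iff)
qed

text \<open>
  Passing to the quotient by \<open>\<plusminus>Id\<close> turns the level \<open>a\<close> into the pair of levels \<open>\<plusminus>a\<close>; this is the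
  source of the absolute value in the wedges and of the two signs in the quadrics.
\<close>

lemma pullback_level:
  assumes "p \<ge> 1"
  shows "pullback p q (hyp_class p q ` {X \<in> hyperboloid p q. form p q X V = a}) =
    {w \<in> half_space p q. \<bar>form p q (iota_lift w) V\<bar> = \<bar>a\<bar> * snd (snd w)}"
proof -
  have "iota p q w \<in> hyp_class p q ` {X \<in> hyperboloid p q. form p q X V = a} \<longleftrightarrow>
      \<bar>form p q (iota_lift w) V\<bar> = \<bar>a\<bar> * snd (snd w)"
    if "w \<in> half_space p q" for w
  proof -
    obtain x y z where w: "w = (x, y, z)" by (cases w)
    note that = that[unfolded w]
    have z: "z > 0" using that by (simp add: half_space_def)
    show ?thesis
      using z unfolding iota_def w
      by (simp add: hyp_class_mem_level_iff[OF iota_lift_in_hyperboloid[OF assms that]]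
          form_smult[OF iota_lift_carrier[OF assms that]] abs_mult field_simps)
  qed
  then show ?thesis
    unfolding pullback_def by (intro Collect_cong conj_cong refl)
qed

lemma pullback_perp:
  assumes "p \<ge> 1"
  shows "pullback p q (perp_hyperplane p q V) =
    {w \<in> half_space p q. form p q (iota_lift w) V = 0}"
proof -
  have "iota p q (x, y, z) \<in> perp_hyperplane p q V \<longleftrightarrow> form p q (iota_lift (x, y, z)) V = 0"
    if w: "(x, y, z) \<in> half_space p q" for x y z
  proof -
    let ?X = "(1 / z) \<cdot>\<^sub>v iota_lift (x, y, z)"
    have z: "z > 0" using w by (simp add: half_space_def)
    have X: "?X \<in> hyperboloid p q" by (rule iota_lift_in_hyperboloid[OF assms w])
    then have C: "?X \<in> carrier_vec (p + q + 1)" by (simp add: hyperboloid_def)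
    have "hyp_class p q ?X \<in> pseudohyp p q"
      using X by (auto simp: pseudohyp_def hyp_class_def quotient_def)
    then have "iota p q (x, y, z) \<in> perp_hyperplane p q V \<longleftrightarrow> form p q ?X V = 0"
      by (simp add: iota_def perp_hyperplane_def hyp_class_eq[OF X] form_uminus[OF C])
    then show ?thesis
      using z by (simp add: form_smult[OF iota_lift_carrier[OF assms w]])
  qed
  then show ?thesis by (auto simp: pullback_def)
qed

section \<open>Points at infinity and their horospheres\<close>

lemma proj_class_eq_iff:
  assumes "V \<in> carrier_vec n" "V \<noteq> 0\<^sub>v n" "W \<in> carrier_vec n" "W \<noteq> 0\<^sub>v n"
  shows "proj_class n V = proj_class n W \<longleftrightarrow> (\<exists>t. t \<noteq> 0 \<and> W = t \<cdot>\<^sub>v V)"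
proof
  assume "proj_class n V = proj_class n W"
  moreover have "W \<in> proj_class n W"
    using assms(3,4) by (auto simp: proj_class_def proportional_rel_def intro!: exI[of _ 1])
  ultimately show "\<exists>t. t \<noteq> 0 \<and> W = t \<cdot>\<^sub>v V"
    by (auto simp: proj_class_def proportional_rel_def)
next
  assume "\<exists>t. t \<noteq> 0 \<and> W = t \<cdot>\<^sub>v V"
  then obtain t where t: "t \<noteq> 0" "W = t \<cdot>\<^sub>v V" by blast
  have "(\<exists>s. s \<noteq> 0 \<and> U = s \<cdot>\<^sub>v V) \<longleftrightarrow> (\<exists>s. s \<noteq> 0 \<and> U = s \<cdot>\<^sub>v W)" for U
  proof
    assume "\<exists>s. s \<noteq> 0 \<and> U = s \<cdot>\<^sub>v V"
    then obtain s where "s \<noteq> 0" "U = s \<cdot>\<^sub>v V" by blast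
    with t have "s / t \<noteq> 0 \<and> U = (s / t) \<cdot>\<^sub>v W" by (simp add: smult_smult_assoc)
    then show "\<exists>s. s \<noteq> 0 \<and> U = s \<cdot>\<^sub>v W" by blast
  next
    assume "\<exists>s. s \<noteq> 0 \<and> U = s \<cdot>\<^sub>v W"
    then obtain s where "s \<noteq> 0" "U = s \<cdot>\<^sub>v W" by blast
    with t have "s * t \<noteq> 0 \<and> U = (s * t) \<cdot>\<^sub>v V" by (simp add: smult_smult_assoc)
    then show "\<exists>s. s \<noteq> 0 \<and> U = s \<cdot>\<^sub>v V" by blast
  qed
  then show "proj_class n V = proj_class n W"
    using assms by (auto simp: proj_class_def proportional_rel_def)
qed

lemma boundary_hyp_eq: "boundary_hyp p q = proj_class (p + q + 1) ` null_vectors p q"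
  by (auto simp: boundary_hyp_def quotient_def proj_class_def)

lemma horospheres_eq: "horospheres p q = (\<Union>P \<in> boundary_hyp p q. horospheres_at p q P)"
  by (auto simp: horospheres_def horospheres_at_def boundary_hyp_eq is_hyp_horosphere_def)

text \<open>
  The definition of a horosphere lets both the representative of the point at infinity and the level
  vary.  A fixed representative \<open>V\<close> suffices, since a factor on \<open>V\<close> can be moved to the level, and
  only the absolute value of the level matters.
\<close>

lemma horospheres_at_proj_class:
  assumes p: "p \<ge> 1" and V: "V \<in> null_vectors p q"
  shows "horospheres_at p q (proj_class (p + q + 1) V) =
    {{w \<in> half_space p q. \<bar>form p q (iota_lift w) V\<bar> = c * snd (snd w)} | c. c > 0}"
    (is "?L = ?R")
proof
  have V': "V \<in> carrier_vec (p + q + 1)" "V \<noteq> 0\<^sub>v (p + q + 1)"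
    using V by (auto simp: null_vectors_def)
  show "?L \<subseteq> ?R"
  proof
    fix H assume "H \<in> ?L"
    then obtain W a where W: "W \<in> null_vectors p q" and a: "a \<noteq> 0"
      and VW: "proj_class (p + q + 1) V = proj_class (p + q + 1) W"
      and H: "H = pullback p q (hyp_class p q ` {X \<in> hyperboloid p q. form p q X W = a})"
      unfolding horospheres_at_def is_hyp_horosphere_def by auto
    obtain t where t: "t \<noteq> 0" "W = t \<cdot>\<^sub>v V"
      using VW W V' proj_class_eq_iff[of V _ W] by (auto simp: null_vectors_def)
    have "H = {w \<in> half_space p q. \<bar>form p q (iota_lift w) V\<bar> = \<bar>a / t\<bar> * snd (snd w)}"
      unfolding H pullback_level[OF p] unfolding t(2) form_smult(2)[OF V'(1)] using t(1)
      by (simp add: abs_mult field_simps)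
    then show "H \<in> ?R" using a t(1) by (auto intro!: exI[of _ "\<bar>a / t\<bar>"])
  qed
  show "?R \<subseteq> ?L"
  proof
    fix H assume "H \<in> ?R"
    then obtain c where c: "c > 0"
      and "H = {w \<in> half_space p q. \<bar>form p q (iota_lift w) V\<bar> = c * snd (snd w)}" by auto
    then have "H = pullback p q (hyp_class p q ` {X \<in> hyperboloid p q. form p q X V = c})"
      by (simp add: pullback_level[OF p])
    with c V show "H \<in> ?L"
      unfolding horospheres_at_def is_hyp_horosphere_def
      by (intro CollectI exI[of _ "hyp_class p q ` {X \<in> hyperboloid p q. form p q X V = c}"])
        (metis order_less_irrefl)
  qed
qed

lemma homog_null_iff:
  assumes "p \<ge> 1" "a \<in> carrier_vec (p - 1)" "b \<in> carrier_vec q"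
  shows "homog a s b t \<in> null_vectors p q \<longleftrightarrow>
    \<not> (a = 0\<^sub>v (p - 1) \<and> s = 0 \<and> b = 0\<^sub>v q \<and> t = 0) \<and> a \<bullet> a + s * s = b \<bullet> b + t * t"
  using homog_carrier[OF assms] homog_eq_0_iff[OF assms] form_homog[OF assms assms(2,3)]
  by (auto simp: null_vectors_def)

subsection \<open>The point \<open>\<infinity>\<close>\<close>

lemma point_infinity_homog:
  assumes "p \<ge> 1"
  shows "point_infinity p q = proj_class (p + q + 1) (homog (0\<^sub>v (p - 1)) 1 (0\<^sub>v q) (- 1))"
proof -
  have "unit_vec (p + q + 1) (p - 1) - unit_vec (p + q + 1) (p + q) =
      homog (0\<^sub>v (p - 1)) 1 (0\<^sub>v q) (- 1 :: real)" (is "?l = ?r")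
  proof (rule eq_vecI)
    fix i assume "i < dim_vec ?r"
    then have i: "i < p + q + 1" using homog_carrier[OF assms zero_carrier_vec zero_carrier_vec, THEN carrier_vecD] by simp
    show "?l $ i = ?r $ i"
      using i assms by (subst homog_index[of p _ _ q]) (auto simp: unit_vec_def)
  qed (use homog_carrier[OF assms zero_carrier_vec zero_carrier_vec, THEN carrier_vecD] in simp)
  then show ?thesis by (simp add: point_infinity_def)
qed

lemma horospheres_at_infinity:
  assumes p: "p \<ge> 1"
  shows "horospheres_at p q (point_infinity p q) = {horizontal p q c | c. c > 0}"
proof -
  let ?V = "homog (0\<^sub>v (p - 1)) 1 (0\<^sub>v q) (- 1)"
  have N: "?V \<in> null_vectors p q" by (simp add: homog_null_iff[OF p])
  have eq: "{w \<in> half_space p q. \<bar>form p q (iota_lift w) ?V\<bar> = c * snd (snd w)} =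
      horizontal p q (1 / c)" if "c > 0" for c
    using that by (auto simp: horizontal_def half_space_def form_iota_lift[OF p] field_simps)
  show ?thesis
    unfolding point_infinity_homog[OF p] horospheres_at_proj_class[OF p N]
  proof safe
    fix c :: real assume c: "c > 0"
    show "\<exists>c'. {w \<in> half_space p q. \<bar>form p q (iota_lift w) ?V\<bar> = c * snd (snd w)} =
        horizontal p q c' \<and> c' > 0"
      using eq[OF c] c by (intro exI[of _ "1 / c"]) simp
    show "\<exists>c'. horizontal p q c =
        {w \<in> half_space p q. \<bar>form p q (iota_lift w) ?V\<bar> = c' * snd (snd w)} \<and> c' > 0"
      using eq[of "1 / c"] c by (intro exI[of _ "1 / c"]) simp
  qed
qed

subsection \<open>Vertical hyperplanes\<close>

lemma null_direction_nonzero: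
  assumes "null_direction p q u v"
  shows "u \<bullet> u > 0" "u \<bullet> u = v \<bullet> v"
proof -
  have uv: "u \<in> carrier_vec (p - 1)" "v \<in> carrier_vec q" "(u, v) \<noteq> (0\<^sub>v (p - 1), 0\<^sub>v q)"
    using assms by (auto simp: null_direction_def)
  show eq: "u \<bullet> u = v \<bullet> v"
    using assms vnorm_square[of u] vnorm_square[of v] by (simp add: null_direction_def)
  show "u \<bullet> u > 0"
    using eq uv scalar_prod_self_eq_0_iff[OF uv(1)] scalar_prod_self_eq_0_iff[OF uv(2)]
      scalar_prod_self_nonneg[of u] by force
qed

text \<open>
  Translating a point along \<open>u\<close>, on which the linear part of the first function is positive, brings
  it to the zero hyperplane of that function, and changes the two functions by amounts in the
  fixed ratio \<open>t\<close>; since both vanish there, they had this ratio at the start.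
\<close>

lemma affine_function_proportional:
  assumes u: "u \<in> carrier_vec n" and v: "v \<in> carrier_vec m" and u0: "u \<bullet> u > (0 :: real)"
    and a: "a \<in> carrier_vec n" and b: "b \<in> carrier_vec m"
    and zero: "\<And>x y. x \<in> carrier_vec n \<Longrightarrow> y \<in> carrier_vec m \<Longrightarrow>
      x \<bullet> u - y \<bullet> v + d = 0 \<Longrightarrow> x \<bullet> a - y \<bullet> b + s = 0"
  obtains t where "a = t \<cdot>\<^sub>v u" "b = t \<cdot>\<^sub>v v" "s = t * d"
proof -
  define t where "t = (u \<bullet> a) / (u \<bullet> u)"
  have multiple: "x \<bullet> a - y \<bullet> b + s = t * (x \<bullet> u - y \<bullet> v + d)"
    if x: "x \<in> carrier_vec n" and y: "y \<in> carrier_vec m" for x y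
  proof -
    \<comment> \<open>The multiple of \<open>u\<close> by which \<open>x\<close> has to be moved to reach the hyperplane.\<close>
    define r where "r = (x \<bullet> u - y \<bullet> v + d) / (u \<bullet> u)"
    have shift: "(x - r \<cdot>\<^sub>v u) \<bullet> w = x \<bullet> w - r * (u \<bullet> w)" if "w \<in> carrier_vec n" for w
      using that x u by (simp add: minus_scalar_prod_distrib[of _ n])
    have "(x - r \<cdot>\<^sub>v u) \<bullet> u - y \<bullet> v + d = 0"
      using u0 unfolding shift[OF u] by (simp add: r_def)
    from zero[OF _ y this] x u
    have "x \<bullet> a - y \<bullet> b + s = r * (u \<bullet> a)" by (simp add: shift[OF a])
    then show ?thesis by (simp add: r_def t_def)
  qed
  have s: "s = t * d" using multiple[of "0\<^sub>v n" "0\<^sub>v m"] u v a b by simp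
  have a_eq: "a = t \<cdot>\<^sub>v u"
  proof (rule vec_eq_of_scalar_prods[OF a])
    fix x :: "real vec" assume x: "x \<in> carrier_vec n"
    show "x \<bullet> a = x \<bullet> (t \<cdot>\<^sub>v u)"
      using multiple[OF x, of "0\<^sub>v m"] s x u v b by (simp add: algebra_simps)
  qed (use u in simp)
  have b_eq: "b = t \<cdot>\<^sub>v v"
  proof (rule vec_eq_of_scalar_prods[OF b])
    fix y :: "real vec" assume y: "y \<in> carrier_vec m"
    show "y \<bullet> b = y \<bullet> (t \<cdot>\<^sub>v v)"
      using multiple[of "0\<^sub>v n" y] s y u v a by (simp add: algebra_simps)
  qed (use v in simp)
  show thesis by (rule that[OF a_eq b_eq s])
qed

lemma vertical_vector_null:
  assumes "p \<ge> 1" "null_direction p q u v"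
  shows "homog u d v (- d) \<in> null_vectors p q"
proof -
  have uv: "u \<in> carrier_vec (p - 1)" "v \<in> carrier_vec q"
    "\<not> (u = 0\<^sub>v (p - 1) \<and> v = 0\<^sub>v q)"
    using assms(2) by (auto simp: null_direction_def)
  show ?thesis
    using uv null_direction_nonzero[OF assms(2)] by (auto simp: homog_null_iff[OF assms(1)])
qed

lemma form_vertical_vector:
  assumes "p \<ge> 1" "null_direction p q u v" "x \<in> carrier_vec (p - 1)" "y \<in> carrier_vec q"
  shows "form p q (iota_lift (x, y, z)) (homog u d v (- d)) = x \<bullet> u - y \<bullet> v + d"
  using assms(2) form_iota_lift[OF assms(1,3,4), of u v z d "- d"] by (simp add: null_direction_def)

text \<open>
  The uniqueness that makes the definite description of the point over a vertical hyperplane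
  meaningful.
\<close>

lemma vertical_hyperplane_determines_point:
  assumes p: "p \<ge> 1" and nd: "null_direction p q u v" and V: "V \<in> null_vectors p q"
    and eq: "pullback p q (perp_hyperplane p q V) = vertical_hyperplane p q u v d"
  shows "proj_class (p + q + 1) V = proj_class (p + q + 1) (homog u d v (- d))"
proof -
  have uv: "u \<in> carrier_vec (p - 1)" "v \<in> carrier_vec q"
    using nd by (auto simp: null_direction_def)
  have "V \<in> carrier_vec (p + q + 1)" using V by (simp add: null_vectors_def)
  then obtain a s b t where ab: "a \<in> carrier_vec (p - 1)" "b \<in> carrier_vec q"
    and V_eq: "V = homog a s b t"
    by (rule homog_cases[OF p])
  have zero: "x \<bullet> a - y \<bullet> b + (s - t) / 2 - (s + t) / 2 * (hform x y + z\<^sup>2) = 0"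
    if xy: "x \<in> carrier_vec (p - 1)" "y \<in> carrier_vec q" "x \<bullet> u - y \<bullet> v + d = 0" and "z > 0"
    for x y z
  proof -
    have "(x, y, z) \<in> vertical_hyperplane p q u v d"
      using that by (simp add: vertical_hyperplane_def half_space_def)
    then show ?thesis
      using xy ab
      by (simp add: eq[symmetric] pullback_perp[OF p] V_eq form_iota_lift[OF p])
  qed
  \<comment> \<open>The form is constant along a vertical line over the hyperplane, which rules out a term in \<open>z\<^sup>2\<close>.\<close>
  have st: "s + t = 0"
  proof -
    \<comment> \<open>Some point of the hyperplane: the multiple of \<open>u\<close> that lies on it.\<close>
    define x where "x = (- d / (u \<bullet> u)) \<cdot>\<^sub>v u"
    have x: "x \<in> carrier_vec (p - 1)" "x \<bullet> u - 0\<^sub>v q \<bullet> v + d = 0"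
      using uv null_direction_nonzero[OF nd] by (auto simp: x_def)
    show ?thesis
      using zero[OF x(1) _ x(2), of 1] zero[OF x(1) _ x(2), of 2]
      by (simp add: field_simps)
  qed
  have aff: "x \<bullet> a - y \<bullet> b + s = 0"
    if "x \<in> carrier_vec (p - 1)" "y \<in> carrier_vec q" "x \<bullet> u - y \<bullet> v + d = 0" for x y
  proof -
    have t: "t = - s" using st by simp
    show ?thesis using zero[OF that, of 1] unfolding t by simp
  qed
  obtain r where r: "a = r \<cdot>\<^sub>v u" "b = r \<cdot>\<^sub>v v" "s = r * d"
    using affine_function_proportional[OF uv null_direction_nonzero(1)[OF nd] ab aff] by blast
  have Vr: "V = r \<cdot>\<^sub>v homog u d v (- d)"
  proof -
    have "t = - s" using st by simp
    then show ?thesis unfolding V_eq smult_homog[OF p uv] r by simp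
  qed
  have N: "homog u d v (- d) \<in> null_vectors p q" by (rule vertical_vector_null[OF p nd])
  have "r \<noteq> 0"
  proof
    assume "r = 0"
    then have "V = 0\<^sub>v (p + q + 1)"
      using Vr N by (auto simp: null_vectors_def)
    then show False using V by (simp add: null_vectors_def)
  qed
  then have "proj_class (p + q + 1) (homog u d v (- d)) = proj_class (p + q + 1) V"
    using Vr V N by (subst proj_class_eq_iff) (auto simp: null_vectors_def)
  then show ?thesis by simp
qed

lemma vertical_point_homog:
  assumes p: "p \<ge> 1" and nd: "null_direction p q u v"
  shows "vertical_point p q u v d = proj_class (p + q + 1) (homog u d v (- d))"
  unfolding vertical_point_def
proof (rule the_equality)
  have "pullback p q (perp_hyperplane p q (homog u d v (- d))) = vertical_hyperplane p q u v d"
    unfolding pullback_perp[OF p] vertical_hyperplane_def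
    by (auto simp: half_space_def form_vertical_vector[OF p nd])
  then show "\<exists>V \<in> null_vectors p q.
      proj_class (p + q + 1) (homog u d v (- d)) = proj_class (p + q + 1) V
      \<and> pullback p q (perp_hyperplane p q V) = vertical_hyperplane p q u v d"
    using vertical_vector_null[OF p nd] by blast
qed (use vertical_hyperplane_determines_point[OF p nd] in blast)

lemma horospheres_at_vertical_point:
  assumes p: "p \<ge> 1" and nd: "null_direction p q u v"
  shows "horospheres_at p q (vertical_point p q u v d) = {wedge p q u v d c | c. c > 0}"
proof -
  let ?V = "homog u d v (- d)"
  have eq: "{w \<in> half_space p q. \<bar>form p q (iota_lift w) ?V\<bar> = c * snd (snd w)} =
      wedge p q u v d (1 / c)" if "c > 0" for c
    using that by (auto simp: wedge_def half_space_def form_vertical_vector[OF p nd] field_simps)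
  show ?thesis
    unfolding vertical_point_homog[OF assms]
      horospheres_at_proj_class[OF p vertical_vector_null[OF assms]]
  proof safe
    fix c :: real assume c: "c > 0"
    show "\<exists>c'. {w \<in> half_space p q. \<bar>form p q (iota_lift w) ?V\<bar> = c * snd (snd w)} =
        wedge p q u v d c' \<and> c' > 0"
      using eq[OF c] c by (intro exI[of _ "1 / c"]) simp
    show "\<exists>c'. wedge p q u v d c =
        {w \<in> half_space p q. \<bar>form p q (iota_lift w) ?V\<bar> = c' * snd (snd w)} \<and> c' > 0"
      using eq[of "1 / c"] c by (intro exI[of _ "1 / c"]) simp
  qed
qed

subsection \<open>Points of the bounding hyperplane\<close>

lemma iota_lift_boundary_null:
  assumes "p \<ge> 1" "x0 \<in> carrier_vec (p - 1)" "y0 \<in> carrier_vec q"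
  shows "iota_lift (x0, y0, 0) \<in> null_vectors p q"
  unfolding iota_lift_homog homog_null_iff[OF assms] hform_scalar_prod
  by (auto simp: field_simps)

text \<open>
  The lift of a boundary point is normalised by \<open>s + t = 1\<close>, so the quadratic part of the form is
  \<open>- (h(x, y) + z\<^sup>2) / 2\<close>; nullity of the lift supplies the constant that completes the square at
  \<open>(x0, y0)\<close>.
\<close>

lemma form_iota_lift_boundary:
  assumes "p \<ge> 1" "x \<in> carrier_vec (p - 1)" "y \<in> carrier_vec q"
    "x0 \<in> carrier_vec (p - 1)" "y0 \<in> carrier_vec q"
  shows "form p q (iota_lift (x, y, z)) (iota_lift (x0, y0, 0)) =
    - ((vnorm (x - x0))\<^sup>2 - (vnorm (y - y0))\<^sup>2 + z\<^sup>2) / 2"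
  unfolding iota_lift_homog[of x0] form_iota_lift[OF assms] hform_scalar_prod
    vnorm_square_diff[OF assms(2,4)] vnorm_square_diff[OF assms(3,5)]
  by (simp add: field_simps)

lemma horospheres_at_iota_boundary:
  assumes p: "p \<ge> 1" and xy0: "x0 \<in> carrier_vec (p - 1)" "y0 \<in> carrier_vec q"
  shows "horospheres_at p q (iota_boundary p q x0 y0) = {quadric p q x0 y0 c | c. c > 0}"
proof -
  have square: "\<bar>- (k + z\<^sup>2) / 2\<bar> = c * z \<longleftrightarrow> k + (z + c)\<^sup>2 = c\<^sup>2 \<or> k + (z - c)\<^sup>2 = c\<^sup>2"
    if "c > 0" "z > 0" for k z c :: real
  proof -
    have "\<bar>- (k + z\<^sup>2) / 2\<bar> = c * z \<longleftrightarrow> \<bar>k + z\<^sup>2\<bar> = \<bar>2 * c * z\<bar>"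
    proof -
      have half: "\<bar>- r / 2\<bar> = \<bar>r\<bar> / 2" for r :: real by simp
      show ?thesis using that unfolding half by (simp add: abs_mult field_simps)
    qed
    also have "\<dots> \<longleftrightarrow> k + z\<^sup>2 = 2 * c * z \<or> k + z\<^sup>2 = - (2 * c * z)"
      by (simp add: abs_eq_iff)
    also have "\<dots> \<longleftrightarrow> k + (z + c)\<^sup>2 = c\<^sup>2 \<or> k + (z - c)\<^sup>2 = c\<^sup>2"
      by (auto simp: power2_eq_square algebra_simps)
    finally show ?thesis .
  qed
  have "{w \<in> half_space p q. \<bar>form p q (iota_lift w) (iota_lift (x0, y0, 0))\<bar> = c * snd (snd w)} =
      quadric p q x0 y0 c" if c: "c > 0" for c
  proof -
    have "\<bar>form p q (iota_lift w) (iota_lift (x0, y0, 0))\<bar> = c * snd (snd w) \<longleftrightarrow>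
        w \<in> quadric p q x0 y0 c" if "w \<in> half_space p q" for w
    proof -
      obtain x y z where w: "w = (x, y, z)" by (cases w)
      then have xyz: "x \<in> carrier_vec (p - 1)" "y \<in> carrier_vec q" "z > 0"
        using that by (auto simp: half_space_def)
      show ?thesis
        using that
        unfolding w form_iota_lift_boundary[OF p xyz(1,2) xy0] snd_conv square[OF c xyz(3)]
        by (simp add: quadric_def)
    qed
    moreover have "quadric p q x0 y0 c \<subseteq> half_space p q" by (auto simp: quadric_def)
    ultimately show ?thesis by blast
  qed
  then show ?thesis
    unfolding iota_boundary_def horospheres_at_proj_class[OF p iota_lift_boundary_null[OF assms]]
    unfolding setcompr_eq_image by (intro image_cong refl) simp
qed

section \<open>Classification of the points at infinity\<close>

text \<open>
  The sum \<open>s + t\<close> of the \<open>p\<close>-th and last coordinates of a null vector separates the points of the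
  affine chart \<open>\<partial>\<H>\<close>, where it can be scaled to \<open>1\<close>, from the points it omits, where it vanishes
  and the remaining blocks \<open>(a, b)\<close> are zero or a null direction.
\<close>

lemma null_point_cases:
  assumes p: "p \<ge> 1" and V: "V \<in> null_vectors p q"
  obtains (infinity) "proj_class (p + q + 1) V = point_infinity p q"
  | (vertical) u v d where "null_direction p q u v"
      "proj_class (p + q + 1) V = vertical_point p q u v d"
  | (boundary) x0 y0 where "x0 \<in> carrier_vec (p - 1)" "y0 \<in> carrier_vec q"
      "proj_class (p + q + 1) V = iota_boundary p q x0 y0"
proof -
  have "V \<in> carrier_vec (p + q + 1)" using V by (simp add: null_vectors_def)
  then obtain a s b t where ab: "a \<in> carrier_vec (p - 1)" "b \<in> carrier_vec q"
    and V_eq: "V = homog a s b t"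
    by (rule homog_cases[OF p])
  have nz: "\<not> (a = 0\<^sub>v (p - 1) \<and> s = 0 \<and> b = 0\<^sub>v q \<and> t = 0)"
    and null: "a \<bullet> a + s * s = b \<bullet> b + t * t"
    using V unfolding V_eq homog_null_iff[OF p ab] by auto
  have same_point: "proj_class (p + q + 1) V = proj_class (p + q + 1) W"
    if "W \<in> null_vectors p q" "V = r \<cdot>\<^sub>v W" "r \<noteq> 0" for W r
  proof -
    have "proj_class (p + q + 1) W = proj_class (p + q + 1) V"
      using V that by (subst proj_class_eq_iff) (auto simp: null_vectors_def)
    then show ?thesis by simp
  qed
  consider "s + t = 0" "(a, b) = (0\<^sub>v (p - 1), 0\<^sub>v q)"
    | "s + t = 0" "(a, b) \<noteq> (0\<^sub>v (p - 1), 0\<^sub>v q)" | "s + t \<noteq> 0" by blast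
  then show thesis
  proof cases
    case 1
    then have t: "t = - s" and s: "s \<noteq> 0" using nz by auto
    have zero: "s \<cdot>\<^sub>v 0\<^sub>v n = 0\<^sub>v n" for n by auto
    have "V = s \<cdot>\<^sub>v homog (0\<^sub>v (p - 1)) 1 (0\<^sub>v q) (- 1)"
      using 1 t smult_homog[OF p, of "0\<^sub>v (p - 1)" "0\<^sub>v q" q s 1 "- 1"]
      by (simp add: V_eq zero)
    from same_point[OF _ this s] show thesis
      by (intro infinity) (simp add: point_infinity_homog[OF p] homog_null_iff[OF p])
  next
    case 2
    then have t: "t = - s" by simp
    have "null_direction p q a b"
      using 2 null ab unfolding null_direction_def t by (simp add: vnorm_def)
    then show thesis
      by (intro vertical[of a b s]) (simp_all add: vertical_point_homog[OF p] V_eq t)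
  next
    case 3
    define m where "m = s + t"
    define x0 y0 where "x0 = (1 / m) \<cdot>\<^sub>v a" and "y0 = (1 / m) \<cdot>\<^sub>v b"
    have m: "m \<noteq> 0" using 3 by (simp add: m_def)
    have xy0: "x0 \<in> carrier_vec (p - 1)" "y0 \<in> carrier_vec q"
      using ab by (auto simp: x0_def y0_def)
    \<comment> \<open>The null condition reads \<open>h(a, b) = m * (t - s)\<close>, so \<open>m\<close>, \<open>a\<close> and \<open>b\<close> determine \<open>s\<close> and \<open>t\<close>.\<close>
    have diff: "m * m * hform x0 y0 = m * (t - s)"
    proof -
      have "m * m * hform x0 y0 = a \<bullet> a - b \<bullet> b"
        using ab m by (simp add: hform_scalar_prod x0_def y0_def field_simps)
      also have "\<dots> = m * (t - s)" using null by (simp add: m_def algebra_simps)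
      finally show ?thesis .
    qed
    then have h: "m * hform x0 y0 = t - s" using m by simp
    have "m \<cdot>\<^sub>v iota_lift (x0, y0, 0) =
        homog (m \<cdot>\<^sub>v x0) ((m - m * hform x0 y0) / 2) (m \<cdot>\<^sub>v y0) ((m + m * hform x0 y0) / 2)"
      unfolding iota_lift_homog smult_homog[OF p xy0] by (simp add: algebra_simps)
    also have "\<dots> = V"
      unfolding h V_eq using m by (simp add: x0_def y0_def smult_smult_assoc) (simp add: m_def)
    finally have "V = m \<cdot>\<^sub>v iota_lift (x0, y0, 0)" by simp
    from same_point[OF iota_lift_boundary_null[OF p xy0] this m] show thesis
      by (intro boundary[OF xy0]) (simp add: iota_boundary_def)
  qed
qed

lemma boundary_hyp_classification:
  assumes p: "p \<ge> 1"
  shows "boundary_hyp p q =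
    {point_infinity p q} \<union>
    {vertical_point p q u v d | u v d. null_direction p q u v} \<union>
    {iota_boundary p q x0 y0 | x0 y0. x0 \<in> carrier_vec (p - 1) \<and> y0 \<in> carrier_vec q}"
    (is "_ = ?R")
proof
  show "boundary_hyp p q \<subseteq> ?R"
  proof
    fix P assume "P \<in> boundary_hyp p q"
    then obtain V where V: "V \<in> null_vectors p q" "P = proj_class (p + q + 1) V"
      by (auto simp: boundary_hyp_eq)
    show "P \<in> ?R" unfolding V(2) by (rule null_point_cases[OF p V(1)]) blast+
  qed
  have "homog (0\<^sub>v (p - 1)) 1 (0\<^sub>v q) (- 1) \<in> null_vectors p q"
    by (simp add: homog_null_iff[OF p])
  then show "?R \<subseteq> boundary_hyp p q"
    using vertical_vector_null[OF p] iota_lift_boundary_null[OF p]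
    by (auto simp: boundary_hyp_eq point_infinity_homog[OF p] vertical_point_homog[OF p]
        iota_boundary_def)
qed

theorem theorem6p3:
  fixes p q :: nat
  assumes "p \<ge> 1"
  shows
    "horospheres p q =
       {horizontal p q c | c. c > 0} \<union>
       {wedge p q u v d c | u v d c. null_direction p q u v \<and> c > 0} \<union>
       {quadric p q x0 y0 c | x0 y0 c.
          x0 \<in> carrier_vec (p - 1) \<and> y0 \<in> carrier_vec q \<and> c > 0}
     \<and> boundary_hyp p q =
       {point_infinity p q} \<union>
       {vertical_point p q u v d | u v d. null_direction p q u v} \<union>
       {iota_boundary p q x0 y0 | x0 y0. x0 \<in> carrier_vec (p - 1) \<and> y0 \<in> carrier_vec q}
     \<and> horospheres_at p q (point_infinity p q) = {horizontal p q c | c. c > 0}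
     \<and> (\<forall>u v d. null_direction p q u v \<longrightarrow>
          horospheres_at p q (vertical_point p q u v d) = {wedge p q u v d c | c. c > 0})
     \<and> (\<forall>x0 y0. x0 \<in> carrier_vec (p - 1) \<and> y0 \<in> carrier_vec q \<longrightarrow>
          horospheres_at p q (iota_boundary p q x0 y0) = {quadric p q x0 y0 c | c. c > 0})"
proof -
  note at = horospheres_at_infinity[OF assms, of q] horospheres_at_vertical_point[OF assms]
    horospheres_at_iota_boundary[OF assms]
  note boundary = boundary_hyp_classification[OF assms, of q]
  have all: "horospheres p q =
       {horizontal p q c | c. c > 0} \<union>
       {wedge p q u v d c | u v d c. null_direction p q u v \<and> c > 0} \<union>
       {quadric p q x0 y0 c | x0 y0 c.
          x0 \<in> carrier_vec (p - 1) \<and> y0 \<in> carrier_vec q \<and> c > 0}" (is "_ = ?R")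
  proof (rule equalityI; rule subsetI)
    fix H assume "H \<in> horospheres p q"
    then obtain P where P: "P \<in> boundary_hyp p q" and H: "H \<in> horospheres_at p q P"
      by (auto simp: horospheres_eq)
    from P consider "P = point_infinity p q"
      | u v d where "null_direction p q u v" "P = vertical_point p q u v d"
      | x0 y0 where "x0 \<in> carrier_vec (p - 1)" "y0 \<in> carrier_vec q"
          "P = iota_boundary p q x0 y0"
      unfolding boundary by blast
    then show "H \<in> ?R"
    proof cases
      case 1
      have "H \<in> {horizontal p q c | c. c > 0}" using H unfolding 1 at(1) .
      then show ?thesis by blast
    next
      case (2 u v d)
      have "H \<in> {wedge p q u v d c | c. c > 0}" using H unfolding 2(2) at(2)[OF 2(1)] .
      then show ?thesis using 2(1) by blast
    next
      case (3 x0 y0)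
      have "H \<in> {quadric p q x0 y0 c | c. c > 0}" using H unfolding 3(3) at(3)[OF 3(1,2)] .
      then show ?thesis using 3(1,2) by blast
    qed
  next
    fix H assume "H \<in> ?R"
    then consider c where "c > 0" "H = horizontal p q c"
      | u v d c where "null_direction p q u v" "c > 0" "H = wedge p q u v d c"
      | x0 y0 c where "x0 \<in> carrier_vec (p - 1)" "y0 \<in> carrier_vec q" "c > 0"
          "H = quadric p q x0 y0 c"
      by blast
    then show "H \<in> horospheres p q"
    proof cases
      case 1
      then have "H \<in> horospheres_at p q (point_infinity p q)" unfolding at(1) by blast
      moreover have "point_infinity p q \<in> boundary_hyp p q" unfolding boundary by blast
      ultimately show ?thesis unfolding horospheres_eq by blast
    next
      case (2 u v d c)
      then have "H \<in> horospheres_at p q (vertical_point p q u v d)"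
        unfolding at(2)[OF 2(1)] by blast
      moreover have "vertical_point p q u v d \<in> boundary_hyp p q"
        using 2(1) unfolding boundary by blast
      ultimately show ?thesis unfolding horospheres_eq by blast
    next
      case (3 x0 y0 c)
      then have "H \<in> horospheres_at p q (iota_boundary p q x0 y0)"
        unfolding at(3)[OF 3(1,2)] by blast
      moreover have "iota_boundary p q x0 y0 \<in> boundary_hyp p q"
        using 3(1,2) unfolding boundary by blast
      ultimately show ?thesis unfolding horospheres_eq by blast
    qed
  qed
  show ?thesis
    by (intro conjI allI impI) (simp_all only: all boundary at)
qed

end
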